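(* Any streaming algorithm for \textsc{Diameter} in the AL model that works correctly on a family of graphs containing all "Simple AL" graphs $S_N(x,y)$ (for all $N$ and all $x,y \in \{0,1\}^N$) and uses $p$ passes over the stream requires $\Omega(n/p)$ bits of memory, where $n$ is the number of vertices.
   Context: For $N \ge 1$ and $x,y \in \{0,1\}^N$, the graph $S_N(x,y)$ has $2N+3$ vertices $a, b, c, \ell_1,\dots,\ell_N, r_1,\dots,r_N$ and edges: $\ell_i r_i$ for all $i$; $c\ell_i$ and $cr_i$ for all $i$; $a\ell_i$ exactly when $x_i = 1$; $br_i$ exactly when $y_i = 1$. \textsc{Diameter}: compute $\max_{s,t} d(s,t)$ (shortest-path distance). In the Adjacency List (AL) streaming model the graph arrives as a sequence of vertices in arbitrary fixed order, each with the full list of its incident edges. A $p$-pass algorithm reads the sequence $p$ times with unlimited computation; memory is measured in bits. "Requires $\Omega(f)$ bits" means there is a constant $c_0>0$ such that every such algorithm uses at least $c_0 f$ bits on some $n$-vertex input from the family, for all sufficiently large $n$ and all $p$.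
   Formalization: The bound is stated for vertex counts n = 2N+3 only, the sizes of the graphs S_N(x,y); for other n the family need not contain any n-vertex graph, so the literal claim for all large n fails. Algorithms are read as deterministic. *)

theory Defs
  imports "Graph_Theory.Graph_Theory"
begin

section \<open>Diameter\<close>

text \<open>
  Undirected simple graphs are finite symmetric loop-free digraphs (\<^locale>\<open>pair_graph\<close>), and
  distances are the library's shortest-path costs with unit weights. Hence vertices in different
  components have distance \<open>\<infinity>\<close>, and a disconnected graph has diameter \<open>\<infinity>\<close>.
\<close>

definition graph_dist :: "'v pair_pre_digraph \<Rightarrow> 'v \<Rightarrow> 'v \<Rightarrow> ereal" where
  "graph_dist G s t = wf_digraph.\<mu> (with_proj G) (\<lambda>_. 1) s t"

definition diameter :: "'v pair_pre_digraph \<Rightarrow> ereal" where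
  "diameter G = Max {graph_dist G s t | s t. s \<in> pverts G \<and> t \<in> pverts G}"

section \<open>Simple AL graphs\<close>

datatype sal_vertex = VA | VB | VC | VL nat | VR nat

definition sal_verts :: "nat \<Rightarrow> sal_vertex set" where
  "sal_verts N = {VA, VB, VC} \<union> VL ` {1..N} \<union> VR ` {1..N}"

definition sal_edges :: "nat \<Rightarrow> (nat \<Rightarrow> bool) \<Rightarrow> (nat \<Rightarrow> bool) \<Rightarrow> sal_vertex rel" where
  "sal_edges N x y =
     {(VL i, VR i) | i. i \<in> {1..N}} \<union>
     {(VC, VL i) | i. i \<in> {1..N}} \<union>
     {(VC, VR i) | i. i \<in> {1..N}} \<union>
     {(VA, VL i) | i. i \<in> {1..N} \<and> x i} \<union>
     {(VB, VR i) | i. i \<in> {1..N} \<and> y i}"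

text \<open>
  The strings \<open>x, y \<in> {0,1}\<^sup>N\<close> are functions on indices of which only the values at \<open>1, \<dots>, N\<close>
  are used. The injection \<open>\<nu>\<close> gives the names under which the vertices appear in the stream, so
  that no particular vertex type or labelling is imposed.
\<close>

definition simple_AL ::
  "(sal_vertex \<Rightarrow> 'v) \<Rightarrow> nat \<Rightarrow> (nat \<Rightarrow> bool) \<Rightarrow> (nat \<Rightarrow> bool) \<Rightarrow> 'v pair_pre_digraph" where
  "simple_AL \<nu> N x y =
     \<lparr> pverts = \<nu> ` sal_verts N,
       parcs = map_prod \<nu> \<nu> ` (sal_edges N x y \<union> (sal_edges N x y)\<inverse>) \<rparr>"

lemma card_simple_AL:
  assumes "inj \<nu>"
  shows "card (pverts (simple_AL \<nu> N x y)) = 2 * N + 3"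
proof -
  have 1: "card (VL ` {1..N}) = N" "card (VR ` {1..N}) = N"
    by (simp_all add: card_image inj_on_def)
  have 2: "VL ` {1..N} \<inter> VR ` {1..N} = {}"
    by auto
  have "card (VL ` {1..N} \<union> VR ` {1..N}) = 2 * N"
    using card_Un_disjoint[OF _ _ 2] by (simp only: 1 mult_2 finite_imageI finite_atLeastAtMost)
  moreover have "card ({VA, VB, VC} \<union> (VL ` {1..N} \<union> VR ` {1..N})) =
      card {VA, VB, VC} + card (VL ` {1..N} \<union> VR ` {1..N})"
    by (rule card_Un_disjoint) auto
  ultimately have "card (sal_verts N) = 2 * N + 3"
    by (simp add: sal_verts_def Un_assoc)
  then show ?thesis
    using assms by (simp add: simple_AL_def card_image inj_on_subset)
qed

lemma pair_graph_simple_AL: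
  assumes "inj \<nu>"
  shows "pair_graph (simple_AL \<nu> N x y)"
proof -
  have V: "finite (sal_verts N)" by (simp add: sal_verts_def)
  have sub: "sal_edges N x y \<subseteq> sal_verts N \<times> sal_verts N"
    unfolding sal_edges_def sal_verts_def by (intro Un_least; clarsimp)
  have fin: "finite (sal_edges N x y)"
    by (rule finite_subset[OF sub finite_cartesian_product[OF V V]])
  have irr: "(u, u) \<notin> sal_edges N x y" for u
    by (simp add: sal_edges_def)
  show ?thesis
  proof
    fix e assume "e \<in> parcs (simple_AL \<nu> N x y)"
    then obtain u v where uv: "(u, v) \<in> sal_edges N x y \<union> (sal_edges N x y)\<inverse>" and e: "e = (\<nu> u, \<nu> v)"
      unfolding simple_AL_def by auto
    have "u \<in> sal_verts N" "v \<in> sal_verts N" "u \<noteq> v"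
      using uv sub irr by blast+
    then show "fst e \<in> pverts (simple_AL \<nu> N x y)" "snd e \<in> pverts (simple_AL \<nu> N x y)"
      "fst e \<noteq> snd e"
      using e injD[OF assms, of u v] by (auto simp: simple_AL_def)
  next
    show "finite (pverts (simple_AL \<nu> N x y))" "finite (parcs (simple_AL \<nu> N x y))"
      using V fin by (simp_all add: simple_AL_def)
    have "(v, u) \<in> map_prod \<nu> \<nu> ` (E \<union> E\<inverse>)" if "(u, v) \<in> map_prod \<nu> \<nu> ` (E \<union> E\<inverse>)" for u v E
      using that by force
    then show "symmetric (with_proj (simple_AL \<nu> N x y))"
      by (simp add: symmetric_def simple_AL_def sym_def)
  qed
qed

section \<open>Streaming algorithms in the adjacency list model\<close>

type_synonym 'v al_token = "'v \<times> 'v list"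

definition al_stream :: "'v pair_pre_digraph \<Rightarrow> 'v al_token list \<Rightarrow> bool" where
  "al_stream G S \<longleftrightarrow>
     distinct (map fst S) \<and> set (map fst S) = pverts G \<and>
     (\<forall>(v, ns) \<in> set S. distinct ns \<and> set ns = {w. (v, w) \<in> parcs G})"

text \<open>
  A deterministic algorithm whose memory content is a bit string. All components may depend on the
  number \<open>n\<close> of vertices (first argument), and a step may depend on the number of tokens read so
  far (second argument), hence on the current pass; neither is charged as memory. A token is
  handled in a single step by an arbitrary function, and only the contents of the memory between
  steps are charged. A model that reads the incident edges one by one, or that has to store \<open>n\<close> or
  its pass counter, is a restriction of this one.
\<close>

record 'v stream_alg =
  alg_init :: "nat \<Rightarrow> bool list"
  alg_step :: "nat \<Rightarrow> nat \<Rightarrow> bool list \<Rightarrow> 'v al_token \<Rightarrow> bool list"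
  alg_answer :: "nat \<Rightarrow> bool list \<Rightarrow> ereal"

fun alg_trace ::
  "'v stream_alg \<Rightarrow> nat \<Rightarrow> nat \<Rightarrow> bool list \<Rightarrow> 'v al_token list \<Rightarrow> bool list list" where
  "alg_trace A n t m [] = [m]"
| "alg_trace A n t m (\<tau> # \<tau>s) = m # alg_trace A n (Suc t) (alg_step A n t m \<tau>) \<tau>s"

definition alg_run :: "'v stream_alg \<Rightarrow> nat \<Rightarrow> 'v al_token list \<Rightarrow> bool list list" where
  "alg_run A p S =
     alg_trace A (length S) 0 (alg_init A (length S)) (concat (replicate p S))"

definition alg_output :: "'v stream_alg \<Rightarrow> nat \<Rightarrow> 'v al_token list \<Rightarrow> ereal" where
  "alg_output A p S = alg_answer A (length S) (last (alg_run A p S))"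

definition alg_memory :: "'v stream_alg \<Rightarrow> nat \<Rightarrow> 'v al_token list \<Rightarrow> nat" where
  "alg_memory A p S = Max (length ` set (alg_run A p S))"

text \<open>The number \<open>p\<close> of passes may depend on the number of vertices.\<close>

definition solves_diameter ::
  "'v stream_alg \<Rightarrow> (nat \<Rightarrow> nat) \<Rightarrow> 'v pair_pre_digraph set \<Rightarrow> bool" where
  "solves_diameter A p F \<longleftrightarrow>
     (\<forall>G\<in>F. \<forall>S. al_stream G S \<longrightarrow> alg_output A (p (card (pverts G))) S = diameter G)"

end

theory Submission
  imports Defs
begin

text \<open>
  For nonempty \<open>x\<close> and \<open>y\<close> the diameter of \<open>S\<^sub>N(x, y)\<close> is at most \<open>3\<close> exactly if \<open>x\<close> and \<open>y\<close>
  intersect, so an algorithm that reads the vertices \<open>a, \<ell>\<^sub>i\<close> first and the others afterwards is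
  a deterministic protocol for set disjointness: the part of the stream before the cut depends only
  on \<open>x\<close>, the part after it only on \<open>y\<close>, and the memory contents at the \<open>2p\<close> changes of side form
  the transcript. The pairs of a set and its complement are a fooling set, so their \<open>2\<^sup>N\<close>
  transcripts are distinct. With memory at most \<open>M\<close> there are at most \<open>2\<^bsup>4pM\<^esup>\<close> transcripts, which
  gives \<open>N \<le> 4pM\<close>.
\<close>

section \<open>Distances and diameters\<close>

text \<open>Adjoining \<open>Id\<close> allows idle steps; deleting them from \<open>k\<close> steps
  leaves a walk with at most \<open>k\<close> arcs.\<close>

lemma graph_dist_le_relpow:
  assumes "pair_wf_digraph G" "(u, v) \<in> (parcs G \<union> Id) ^^ k" "u \<in> pverts G"
  shows "graph_dist G u v \<le> ereal (real k)"
proof -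
  interpret pair_wf_digraph G by fact
  have "\<exists>q. awalk u q v \<and> length q \<le> k"
    using assms(2,3)
  proof (induction k arbitrary: u)
    case 0
    then show ?case by (auto intro: exI[of _ "[]"] simp: awalk_Nil_iff)
  next
    case (Suc k)
    then obtain w where w: "(u, w) \<in> parcs G \<union> Id" "(w, v) \<in> (parcs G \<union> Id) ^^ k"
      by (meson relpow_Suc_E2)
    have "w \<in> pverts G"
      using w(1) Suc.prems(2) in_arcsD2 by auto
    then obtain q where q: "awalk w q v" "length q \<le> k"
      using Suc.IH w(2) by blast
    show ?case
    proof (cases "u = w")
      case True
      then show ?thesis using q by (intro exI[of _ q]) simp
    next
      case False
      then have "awalk u ((u, w) # q) v"
        using w(1) q(1) by (simp add: awalk_Cons_iff)
      then show ?thesis using q(2) by (intro exI[of _ "(u, w) # q"]) simp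
    qed
  qed
  then obtain q where q: "awalk u q v" "length q \<le> k" by blast
  have "awalk_cost (\<lambda>_. 1) q = real (length q)"
    by (induction q) auto
  then have "graph_dist G u v \<le> ereal (real (length q))"
    unfolding graph_dist_def using min_cost_le_walk_cost[OF q(1), of "\<lambda>_. 1"] by simp
  also have "\<dots> \<le> ereal (real k)" using q(2) by simp
  finally show ?thesis .
qed

text \<open>Each arc raises the potential \<open>h\<close> by at most 1, so a walk costs at least
  its total rise. If there is no walk, the distance is an infimum over the empty set, hence
  infinite.\<close>

lemma graph_dist_ge_potential:
  fixes h :: "'v \<Rightarrow> nat"
  assumes "pair_wf_digraph G" and h: "\<And>u v. (u, v) \<in> parcs G \<Longrightarrow> h v \<le> Suc (h u)"
  shows "ereal (real (h v) - real (h u)) \<le> graph_dist G u v"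
proof -
  interpret pair_wf_digraph G by fact
  have "real (h v) - real (h u) \<le> awalk_cost (\<lambda>_. 1) q" if "awalk u q v" for q
    using that
  proof (induction q arbitrary: u)
    case Nil
    then show ?case by (simp add: awalk_Nil_iff)
  next
    case (Cons e q)
    then have e: "e \<in> parcs G" "fst e = u" "awalk (snd e) q v"
      by (auto simp: awalk_Cons_iff)
    have "real (h (snd e)) \<le> 1 + real (h u)"
      using h[of u "snd e"] e(1,2) by (cases e) auto
    then show ?case using Cons.IH[OF e(3)] by simp
  qed
  then show ?thesis
    unfolding graph_dist_def \<mu>_def by (auto intro: INF_greatest)
qed

lemma diameter_eq_Max_image:
  "diameter G = Max ((\<lambda>(s, t). graph_dist G s t) ` (pverts G \<times> pverts G))"
  unfolding diameter_def by (rule arg_cong[where f = Max]) auto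

lemma graph_dist_le_diameter:
  assumes "finite (pverts G)" "s \<in> pverts G" "t \<in> pverts G"
  shows "graph_dist G s t \<le> diameter G"
  unfolding diameter_eq_Max_image using assms by (intro Max_ge) auto

lemma diameter_leI:
  assumes "finite (pverts G)" "pverts G \<noteq> {}"
    and "\<And>s t. s \<in> pverts G \<Longrightarrow> t \<in> pverts G \<Longrightarrow> graph_dist G s t \<le> d"
  shows "diameter G \<le> d"
  unfolding diameter_eq_Max_image using assms by (subst Max_le_iff) auto

text \<open>A common index \<open>i\<close> opens the path \<open>VA\<close>, \<open>VL i\<close>,
  \<open>VR i\<close>, \<open>VB\<close>. All vertices other than \<open>VA\<close> and
  \<open>VB\<close> are within one step of \<open>VC\<close>, and these two reach it in two steps
  through \<open>VL i\<close> and \<open>VR i\<close>.\<close>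

lemma diameter_simple_AL_le:
  assumes "inj \<nu>" "i \<in> {1..N}" "x i" "y i"
  shows "diameter (simple_AL \<nu> N x y) \<le> 3"
proof -
  let ?G = "simple_AL \<nu> N x y"
  interpret pair_graph ?G by (rule pair_graph_simple_AL) fact
  \<comment> \<open>With \<open>Id\<close> included, every pair can be joined by exactly three
    steps, shorter walks being padded.\<close>
  define E where "E = sal_edges N x y \<union> (sal_edges N x y)\<inverse> \<union> Id"
  have arc: "(\<nu> u, \<nu> v) \<in> parcs ?G \<union> Id" if "(u, v) \<in> E" for u v
    using that unfolding E_def simple_AL_def by (auto intro: rev_image_eqI)
  have walk: "\<exists>q r. (u, q) \<in> E \<and> (q, r) \<in> E \<and> (r, v) \<in> E"
    if "u \<in> sal_verts N" "v \<in> sal_verts N" for u v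
  proof -
    have symE: "(v, u) \<in> E" if "(u, v) \<in> E" for u v
      using that unfolding E_def by auto
    have refl: "(w, w) \<in> E" for w
      unfolding E_def by simp
    have i: "(VA, VL i) \<in> E" "(VL i, VR i) \<in> E" "(VR i, VB) \<in> E" "(VL i, VC) \<in> E" "(VR i, VC) \<in> E"
      using assms(2-4) unfolding E_def sal_edges_def by auto
    have near: "(w, VC) \<in> E" if "w \<in> sal_verts N" "w \<noteq> VA" "w \<noteq> VB" for w
      using that unfolding sal_verts_def E_def sal_edges_def by auto
    consider "u \<notin> {VA, VB}" "v \<notin> {VA, VB}" | "u \<in> {VA, VB}" "v \<notin> {VA, VB}"
      | "u \<notin> {VA, VB}" "v \<in> {VA, VB}" | "u \<in> {VA, VB}" "v \<in> {VA, VB}"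
      by blast
    then show ?thesis
    proof cases
      case 1
      then have "(u, VC) \<in> E" "(VC, v) \<in> E" using that near symE by simp_all
      then show ?thesis using refl by blast
    next
      case 2
      then have "(VC, v) \<in> E" using that near symE by simp
      moreover have "\<exists>q. (u, q) \<in> E \<and> (q, VC) \<in> E" using 2 i symE by blast
      ultimately show ?thesis by blast
    next
      case 3
      then have "(u, VC) \<in> E" using that near by simp
      moreover have "\<exists>q. (v, q) \<in> E \<and> (q, VC) \<in> E" using 3 i symE by blast
      ultimately show ?thesis using symE by blast
    next
      case 4
      then show ?thesis using i(1-3) refl symE by (cases "u = v") blast+
    qed
  qed
  have "graph_dist ?G (\<nu> u) (\<nu> v) \<le> 3" if uv: "u \<in> sal_verts N" "v \<in> sal_verts N" for u v
  proof -
    obtain q r where "(u, q) \<in> E" "(q, r) \<in> E" "(r, v) \<in> E"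
      using walk[OF uv] by blast
    then have "(\<nu> u, \<nu> v) \<in> (parcs ?G \<union> Id) ^^ 3"
      using arc unfolding numeral_3_eq_3 by (meson relpow_0_I relpow_Suc_I)
    then show ?thesis
      using graph_dist_le_relpow[OF pair_wf_digraph_axioms, of "\<nu> u" "\<nu> v" 3] uv
      by (simp add: simple_AL_def)
  qed
  then show ?thesis
    by (intro diameter_leI) (auto simp: simple_AL_def sal_verts_def)
qed

lemma diameter_simple_AL_ge:
  assumes "inj \<nu>" "\<And>i. i \<in> {1..N} \<Longrightarrow> \<not> (x i \<and> y i)"
  shows "4 \<le> diameter (simple_AL \<nu> N x y)"
proof -
  let ?G = "simple_AL \<nu> N x y"
  interpret pair_graph ?G by (rule pair_graph_simple_AL) fact
  \<comment> \<open>The potential leaves the middle level 2 only where an edge to \<open>VA\<close>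
    or \<open>VB\<close> forces it. An edge from \<open>VL i\<close> to \<open>VR i\<close> could
    rise by 2 only if \<open>x i\<close> and \<open>y i\<close> both held.\<close>
  define h :: "sal_vertex \<Rightarrow> nat" where
    "h w = (case w of VA \<Rightarrow> 0 | VB \<Rightarrow> 4 | VC \<Rightarrow> 2
      | VL i \<Rightarrow> if x i then 1 else 2 | VR i \<Rightarrow> if y i then 3 else 2)" for w
  have "h v \<le> Suc (h u) \<and> h u \<le> Suc (h v)" if "(u, v) \<in> sal_edges N x y" for u v
    using that assms(2) unfolding sal_edges_def h_def by auto
  then have "(h \<circ> inv \<nu>) v \<le> Suc ((h \<circ> inv \<nu>) u)" if "(u, v) \<in> parcs ?G" for u v
    using that assms(1) unfolding simple_AL_def by auto
  from graph_dist_ge_potential[where h = "h \<circ> inv \<nu>", OF pair_wf_digraph_axioms this,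
      of "\<nu> VB" "\<nu> VA"]
  have "4 \<le> graph_dist ?G (\<nu> VA) (\<nu> VB)"
    using assms(1) by (simp add: h_def)
  also have "\<dots> \<le> diameter ?G"
    by (intro graph_dist_le_diameter) (auto simp: simple_AL_def sal_verts_def)
  finally show ?thesis .
qed

section \<open>Transcripts of a streaming algorithm\<close>

fun alg_exec ::
  "'v stream_alg \<Rightarrow> nat \<Rightarrow> nat \<Rightarrow> bool list \<Rightarrow> 'v al_token list \<Rightarrow> bool list" where
  "alg_exec A n t m [] = m"
| "alg_exec A n t m (\<tau> # \<tau>s) = alg_exec A n (Suc t) (alg_step A n t m \<tau>) \<tau>s"

lemma alg_exec_append:
  "alg_exec A n t m (xs @ ys) = alg_exec A n (t + length xs) (alg_exec A n t m xs) ys"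
  by (induction xs arbitrary: t m) auto

lemma last_alg_trace: "last (alg_trace A n t m xs) = alg_exec A n t m xs"
proof (induction xs arbitrary: t m)
  case (Cons \<tau> xs)
  have "alg_trace A n t' m' xs \<noteq> []" for t' m'
    by (cases xs) auto
  then show ?case using Cons by simp
qed simp

lemma alg_exec_in_trace: "alg_exec A n t m xs \<in> set (alg_trace A n t m (xs @ ys))"
proof (induction xs arbitrary: t m)
  case Nil
  show ?case by (cases ys) auto
qed simp

definition pass_mem :: "'v stream_alg \<Rightarrow> nat \<Rightarrow> 'v al_token list \<Rightarrow> bool list" where
  "pass_mem A k S = alg_exec A (length S) 0 (alg_init A (length S)) (concat (replicate k S))"

text \<open>The message that the reader of \<open>a\<close> hands to the reader of \<open>b\<close>
  in pass \<open>k\<close>, counted from 0. The start time is the number of tokens read in earlier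
  passes.\<close>

definition cut_mem ::
  "'v stream_alg \<Rightarrow> nat \<Rightarrow> 'v al_token list \<Rightarrow> 'v al_token list \<Rightarrow> bool list" where
  "cut_mem A k a b =
     alg_exec A (length (a @ b)) (k * length (a @ b)) (pass_mem A k (a @ b)) a"

text \<open>The initial memory is left out: it depends only on the length of the stream.\<close>

definition transcript ::
  "'v stream_alg \<Rightarrow> nat \<Rightarrow> 'v al_token list \<Rightarrow> 'v al_token list \<Rightarrow> (bool list \<times> bool list) list"
where
  "transcript A p a b = map (\<lambda>k. (cut_mem A k a b, pass_mem A (Suc k) (a @ b))) [0..<p]"

lemma concat_replicate_Suc: "concat (replicate (Suc k) S) = concat (replicate k S) @ S"
  by (metis concat.simps concat_append append_Nil2 replicate_Suc replicate_append_same)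

lemma length_concat_replicate: "length (concat (replicate k S)) = k * length S"
  by (induction k) auto

lemma pass_mem_Suc:
  "pass_mem A (Suc k) (a @ b) =
     alg_exec A (length (a @ b)) (k * length (a @ b) + length a) (cut_mem A k a b) b"
  unfolding cut_mem_def pass_mem_def concat_replicate_Suc
  by (simp only: alg_exec_append length_concat_replicate add_0)

text \<open>As a single run on a prefix of the repeated stream, the cut memory is seen to occur in
  the trace and so to be charged.\<close>

lemma cut_mem_eq:
  "cut_mem A k a b = alg_exec A (length (a @ b)) 0 (alg_init A (length (a @ b)))
     (concat (replicate k (a @ b)) @ a)"
  unfolding cut_mem_def pass_mem_def by (simp only: alg_exec_append length_concat_replicate add_0)

lemma concat_replicate_split:
  assumes "k < p"
  shows "concat (replicate p S) = concat (replicate k S) @ S @ concat (replicate (p - Suc k) S)"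
proof -
  have "replicate p S = replicate k S @ S # replicate (p - Suc k) S"
    using assms by (simp add: replicate_add[symmetric] flip: replicate_Suc)
  then show ?thesis by simp
qed

lemma transcript_mem_in_run:
  assumes "k < p"
  shows "cut_mem A k a b \<in> set (alg_run A p (a @ b))"
    and "pass_mem A (Suc k) (a @ b) \<in> set (alg_run A p (a @ b))"
proof -
  have split: "concat (replicate p (a @ b)) =
      (concat (replicate k (a @ b)) @ a) @ b @ concat (replicate (p - Suc k) (a @ b))"
    using concat_replicate_split[OF assms, of "a @ b"] by simp
  show "cut_mem A k a b \<in> set (alg_run A p (a @ b))"
    unfolding alg_run_def split cut_mem_eq by (rule alg_exec_in_trace)
  have split': "concat (replicate p (a @ b)) =
      concat (replicate (Suc k) (a @ b)) @ concat (replicate (p - Suc k) (a @ b))"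
    unfolding concat_replicate_Suc using concat_replicate_split[OF assms, of "a @ b"] by simp
  show "pass_mem A (Suc k) (a @ b) \<in> set (alg_run A p (a @ b))"
    unfolding alg_run_def split' pass_mem_def by (rule alg_exec_in_trace)
qed

lemma length_le_alg_memory:
  assumes "m \<in> set (alg_run A p S)"
  shows "length m \<le> alg_memory A p S"
  unfolding alg_memory_def using assms by (intro Max_ge) auto

text \<open>Induction over the passes: on \<open>a @ b'\<close> the first half sees the same
  messages as in \<open>a @ b\<close>, the second half the same as in \<open>a' @ b'\<close>. Equal
  lengths keep the vertex count and the step counter in agreement.\<close>

lemma transcript_cut_and_paste:
  assumes len: "length a = length a'" "length b = length b'"
    and eq: "transcript A p a b = transcript A p a' b'" and "k \<le> p"
  shows "pass_mem A k (a @ b') = pass_mem A k (a @ b)"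
  using \<open>k \<le> p\<close>
proof (induction k)
  case 0
  then show ?case using len by (simp add: pass_mem_def)
next
  case (Suc k)
  then have at: "cut_mem A k a b = cut_mem A k a' b'"
    "pass_mem A (Suc k) (a @ b) = pass_mem A (Suc k) (a' @ b')"
    using eq by (auto simp: transcript_def)
  have "cut_mem A k a b' = cut_mem A k a' b'"
    using Suc at(1) len by (simp add: cut_mem_def)
  then show ?case
    unfolding at(2) using len by (simp only: pass_mem_Suc length_append)
qed

lemma alg_output_eq_pass_mem: "alg_output A p S = alg_answer A (length S) (pass_mem A p S)"
  by (simp add: alg_output_def alg_run_def last_alg_trace pass_mem_def)

text \<open>Inputs with one transcript form a combinatorial rectangle. The second mixed pair is the
  first with the roles exchanged; the last message, which is the final memory, links the
  two.\<close>

lemma transcript_rectangle: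
  assumes len: "length a = length a'" "length b = length b'"
    and eq: "transcript A p a b = transcript A p a' b'"
  shows "alg_output A p (a @ b') = alg_output A p (a @ b)"
    and "alg_output A p (a' @ b) = alg_output A p (a @ b)"
proof -
  have 1: "pass_mem A p (a @ b') = pass_mem A p (a @ b)"
    by (rule transcript_cut_and_paste[OF len eq]) simp
  have 2: "pass_mem A p (a' @ b) = pass_mem A p (a' @ b')"
    by (rule transcript_cut_and_paste[OF len[symmetric] eq[symmetric]]) simp
  have 3: "pass_mem A p (a @ b) = pass_mem A p (a' @ b')"
  proof (cases p)
    \<comment> \<open>Without passes the transcript is empty, and both memories are the initial
      one.\<close>
    case 0
    then show ?thesis using len by (simp add: pass_mem_def)
  next
    case (Suc k)
    then show ?thesis using eq by (auto simp: transcript_def)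
  qed
  show "alg_output A p (a @ b') = alg_output A p (a @ b)"
    "alg_output A p (a' @ b) = alg_output A p (a @ b)"
    using 1 2 3 len by (simp_all add: alg_output_eq_pass_mem)
qed

text \<open>
  The bound \<open>2\<^bsup>2M\<^esup>\<close> is weak for large \<open>M\<close>, but unlike \<open>2\<^bsup>M + 1\<^esup>\<close> it is sharp at \<open>M = 0\<close>, which
  matters if there are more than linearly many passes.
\<close>

lemma card_bool_lists_length_le:
  "finite {m :: bool list. length m \<le> M}" "card {m :: bool list. length m \<le> M} \<le> 2 ^ (2 * M)"
proof -
  have eq: "{m :: bool list. length m \<le> M} = {m. set m \<subseteq> UNIV \<and> length m \<le> M}"
    by simp
  show "finite {m :: bool list. length m \<le> M}"
    unfolding eq by (rule finite_lists_length_le) simp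
  have "card {m :: bool list. length m \<le> M} = (\<Sum>i\<le>M. 2 ^ i)"
    unfolding eq by (subst card_lists_length_le) simp_all
  also have "\<dots> \<le> 2 ^ (2 * M)"
  proof (induction M)
    case (Suc M)
    \<comment> \<open>The old sum and the new term together stay below
      \<open>3 * 2 ^ (2 * M)\<close>.\<close>
    have "(2::nat) ^ M \<le> 2 ^ (2 * M)" by (intro power_increasing) simp_all
    then have "(2::nat) ^ Suc M \<le> 2 * 2 ^ (2 * M)" by simp
    moreover have "(2::nat) ^ (2 * Suc M) = 4 * 2 ^ (2 * M)" by simp
    moreover have "(\<Sum>i\<le>Suc M. (2::nat) ^ i) = (\<Sum>i\<le>M. 2 ^ i) + 2 ^ Suc M" by simp
    ultimately show ?case using Suc.IH by linarith
  qed simp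
  finally show "card {m :: bool list. length m \<le> M} \<le> 2 ^ (2 * M)" .
qed

text \<open>A transcript is a word of length \<open>p\<close> over pairs of memory contents, and
  there are at most \<open>2 ^ (2 * M)\<close> contents.\<close>

lemma card_le_if_distinct_transcripts:
  assumes inj: "inj_on (\<lambda>z. transcript A p (a z) (b z)) Z"
    and M: "\<And>z. z \<in> Z \<Longrightarrow> alg_memory A p (a z @ b z) \<le> M"
  shows "card Z \<le> 2 ^ (4 * p * M)"
proof -
  define Q where "Q = {m :: bool list. length m \<le> M}"
  have Q: "finite Q" "card Q \<le> 2 ^ (2 * M)"
    unfolding Q_def by (fact card_bool_lists_length_le)+
  let ?L = "{xs. set xs \<subseteq> Q \<times> Q \<and> length xs = p}"
  have "(\<lambda>z. transcript A p (a z) (b z)) ` Z \<subseteq> ?L"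
  proof (clarsimp simp: transcript_def)
    fix z k assume z: "z \<in> Z" and k: "k < p"
    show "cut_mem A k (a z) (b z) \<in> Q \<and> pass_mem A (Suc k) (a z @ b z) \<in> Q"
      using transcript_mem_in_run[OF k, THEN length_le_alg_memory, THEN order_trans, OF M[OF z]]
      by (simp add: Q_def)
  qed
  moreover have "finite ?L"
    using Q(1) by (intro finite_lists_length_eq) simp
  ultimately have "card Z \<le> card ?L"
    using card_inj_on_le[OF inj] by blast
  also have "\<dots> = (card Q * card Q) ^ p"
    using Q(1) by (simp add: card_lists_length_eq card_cartesian_product)
  also have "\<dots> \<le> (2 ^ (2 * M) * 2 ^ (2 * M)) ^ p"
    using Q(2) by (intro power_mono mult_mono) auto
  also have "\<dots> = 2 ^ (4 * p * M)"
    by (simp add: power_add[symmetric] power_mult[symmetric] algebra_simps)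
  finally show ?thesis .
qed

section \<open>Streams of simple AL graphs\<close>

text \<open>The choice by \<open>SOME\<close> depends on the neighbourhood alone, so graphs that
  agree around a vertex yield literally the same token.\<close>

definition nbr_tokens :: "'v pair_pre_digraph \<Rightarrow> 'v list \<Rightarrow> 'v al_token list" where
  "nbr_tokens G vs = map (\<lambda>v. (v, SOME ns. distinct ns \<and> set ns = {w. (v, w) \<in> parcs G})) vs"

lemma length_nbr_tokens [simp]: "length (nbr_tokens G vs) = length vs"
  by (simp add: nbr_tokens_def)

lemma nbr_tokens_append: "nbr_tokens G (us @ vs) = nbr_tokens G us @ nbr_tokens G vs"
  by (simp add: nbr_tokens_def)

lemma nbr_tokens_cong:
  assumes "\<And>v w. v \<in> set vs \<Longrightarrow> (v, w) \<in> parcs G \<longleftrightarrow> (v, w) \<in> parcs H"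
  shows "nbr_tokens G vs = nbr_tokens H vs"
  using assms by (auto simp: nbr_tokens_def)

lemma al_stream_nbr_tokens:
  assumes "finite (parcs G)" "distinct vs" "set vs = pverts G"
  shows "al_stream G (nbr_tokens G vs)"
proof -
  have "distinct (SOME ns. distinct ns \<and> set ns = {w. (v, w) \<in> parcs G}) \<and>
      set (SOME ns. distinct ns \<and> set ns = {w. (v, w) \<in> parcs G}) = {w. (v, w) \<in> parcs G}" for v
  proof (rule someI_ex)
    have "{w. (v, w) \<in> parcs G} \<subseteq> snd ` parcs G" by force
    then have "finite {w. (v, w) \<in> parcs G}"
      using assms(1) finite_subset by blast
    then show "\<exists>ns. distinct ns \<and> set ns = {w. (v, w) \<in> parcs G}"
      using finite_distinct_list by blast
  qed
  then show ?thesis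
    using assms(2,3) by (auto simp: al_stream_def nbr_tokens_def comp_def)
qed

definition x_side :: "(sal_vertex \<Rightarrow> 'v) \<Rightarrow> nat \<Rightarrow> 'v list" where
  "x_side \<nu> N = map \<nu> (VA # map VL [1..<Suc N])"

text \<open>The neighbourhood of \<open>VC\<close> depends on neither string, so \<open>VC\<close>
  may be put on this side.\<close>

definition y_side :: "(sal_vertex \<Rightarrow> 'v) \<Rightarrow> nat \<Rightarrow> 'v list" where
  "y_side \<nu> N = map \<nu> (VB # VC # map VR [1..<Suc N])"

definition sal_stream ::
  "(sal_vertex \<Rightarrow> 'v) \<Rightarrow> nat \<Rightarrow> (nat \<Rightarrow> bool) \<Rightarrow> (nat \<Rightarrow> bool) \<Rightarrow> 'v al_token list" where
  "sal_stream \<nu> N x y =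
     nbr_tokens (simple_AL \<nu> N x y) (x_side \<nu> N) @ nbr_tokens (simple_AL \<nu> N x y) (y_side \<nu> N)"

lemma al_stream_sal_stream:
  assumes "inj \<nu>"
  shows "al_stream (simple_AL \<nu> N x y) (sal_stream \<nu> N x y)"
proof -
  interpret pair_graph "simple_AL \<nu> N x y" by (rule pair_graph_simple_AL) fact
  have upt: "set [1..<Suc N] = {1..N}" by auto
  have "distinct ((VA # map VL [1..<Suc N]) @ VB # VC # map VR [1..<Suc N])"
    by (auto simp: distinct_map inj_on_def simp del: upt_Suc)
  then have "distinct (x_side \<nu> N @ y_side \<nu> N)"
    unfolding x_side_def y_side_def map_append[symmetric] distinct_map
    using inj_on_subset[OF assms subset_UNIV] by (intro conjI)
  moreover have "set (x_side \<nu> N @ y_side \<nu> N) = pverts (simple_AL \<nu> N x y)"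
    unfolding x_side_def y_side_def simple_AL_def sal_verts_def set_append set_map list.set upt
    by auto
  ultimately show ?thesis
    unfolding sal_stream_def nbr_tokens_append[symmetric]
    by (intro al_stream_nbr_tokens) auto
qed

lemma arc_simple_AL_iff:
  assumes "inj \<nu>"
  shows "(\<nu> u, w) \<in> parcs (simple_AL \<nu> N x y) \<longleftrightarrow>
    (\<exists>v. w = \<nu> v \<and> (u, v) \<in> sal_edges N x y \<union> (sal_edges N x y)\<inverse>)"
  using assms by (auto simp: simple_AL_def inj_eq)

text \<open>The string \<open>y\<close> decides only arcs between \<open>VB\<close> and the
  \<open>VR i\<close>, and none of these vertices is listed on this side.\<close>

lemma x_side_tokens_indep:
  assumes "inj \<nu>"
  shows "nbr_tokens (simple_AL \<nu> N x y) (x_side \<nu> N) = nbr_tokens (simple_AL \<nu> N x y') (x_side \<nu> N)"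
proof (rule nbr_tokens_cong)
  fix v w assume "v \<in> set (x_side \<nu> N)"
  then obtain u where "v = \<nu> u" "u = VA \<or> (\<exists>i. u = VL i)"
    by (auto simp: x_side_def)
  then show "(v, w) \<in> parcs (simple_AL \<nu> N x y) \<longleftrightarrow> (v, w) \<in> parcs (simple_AL \<nu> N x y')"
    using assms by (auto simp: arc_simple_AL_iff sal_edges_def)
qed

lemma y_side_tokens_indep:
  assumes "inj \<nu>"
  shows "nbr_tokens (simple_AL \<nu> N x y) (y_side \<nu> N) = nbr_tokens (simple_AL \<nu> N x' y) (y_side \<nu> N)"
proof (rule nbr_tokens_cong)
  fix v w assume "v \<in> set (y_side \<nu> N)"
  then obtain u where "v = \<nu> u" "u = VB \<or> u = VC \<or> (\<exists>i. u = VR i)"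
    by (auto simp: y_side_def)
  then show "(v, w) \<in> parcs (simple_AL \<nu> N x y) \<longleftrightarrow> (v, w) \<in> parcs (simple_AL \<nu> N x' y)"
    using assms by (auto simp: arc_simple_AL_iff sal_edges_def)
qed

lemma alg_memory_simple_AL_ge:
  assumes inj: "inj \<nu>"
    and out: "\<And>x y. alg_output A p (sal_stream \<nu> N x y) = diameter (simple_AL \<nu> N x y)"
  shows "\<exists>x y. N \<le> 4 * p * alg_memory A p (sal_stream \<nu> N x y)"
proof -
  define a where "a X = nbr_tokens (simple_AL \<nu> N (\<lambda>i. i \<in> X) (\<lambda>i. i \<notin> X)) (x_side \<nu> N)" for X
  define b where "b X = nbr_tokens (simple_AL \<nu> N (\<lambda>i. i \<in> X) (\<lambda>i. i \<notin> X)) (y_side \<nu> N)" for X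
  \<comment> \<open>The mixed stream encodes \<open>X\<close> against the complement of
    \<open>Y\<close>; these intersect exactly in \<open>X - Y\<close>.\<close>
  have ab: "a X @ b Y = sal_stream \<nu> N (\<lambda>i. i \<in> X) (\<lambda>i. i \<notin> Y)" for X Y
    unfolding a_def b_def sal_stream_def
    using x_side_tokens_indep[OF inj, of N "\<lambda>i. i \<in> X"] y_side_tokens_indep[OF inj, of N _ "\<lambda>i. i \<notin> Y"]
    by metis
  have len: "length (a X) = length (a Y)" "length (b X) = length (b Y)" for X Y
    by (simp_all add: a_def b_def)
  have disj: "4 \<le> alg_output A p (a X @ b X)" for X
    unfolding ab out by (rule diameter_simple_AL_ge[OF inj]) simp
  have meet: "alg_output A p (a X @ b Y) \<le> 3" if "i \<in> {1..N}" "i \<in> X" "i \<notin> Y" for i X Y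
    unfolding ab out using diameter_simple_AL_le[OF inj that(1)] that(2,3) by simp
  have "X = Y"
    if XY: "X \<subseteq> {1..N}" "Y \<subseteq> {1..N}" and eq: "transcript A p (a X) (b X) = transcript A p (a Y) (b Y)"
    for X Y
  proof (rule ccontr)
    assume "X \<noteq> Y"
    \<comment> \<open>An index in the symmetric difference lies in \<open>X - Y\<close> or in
      \<open>Y - X\<close>, so at least one of the two mixed pairs intersects, while the rectangle
      property gives both the output of \<open>a X @ b X\<close>.\<close>
    then obtain i where i: "i \<in> {1..N}" "i \<in> X \<and> i \<notin> Y \<or> i \<in> Y \<and> i \<notin> X"
      using XY by blast
    then have "alg_output A p (a X @ b Y) \<le> 3 \<or> alg_output A p (a Y @ b X) \<le> 3"
      using meet by blast
    then have "alg_output A p (a X @ b X) \<le> 3"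
      using transcript_rectangle[OF len eq] by simp
    with disj[of X] have "(4::ereal) \<le> 3" by (rule order_trans)
    then show False by simp
  qed
  then have inj_tr: "inj_on (\<lambda>X. transcript A p (a X) (b X)) (Pow {1..N})"
    by (intro inj_onI) auto
  define mem where "mem X = alg_memory A p (a X @ b X)" for X
  have fin: "finite (mem ` Pow {1..N})" by simp
  have "mem X \<le> Max (mem ` Pow {1..N})" if "X \<in> Pow {1..N}" for X
    using fin that by (intro Max_ge) auto
  with inj_tr have "card (Pow {1..N}) \<le> 2 ^ (4 * p * Max (mem ` Pow {1..N}))"
    unfolding mem_def by (rule card_le_if_distinct_transcripts)
  then have le: "N \<le> 4 * p * Max (mem ` Pow {1..N})"
    by (simp add: card_Pow)
  \<comment> \<open>The maximum is attained, which turns the bound over the whole fooling set into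
    one on a single input.\<close>
  have "Max (mem ` Pow {1..N}) \<in> mem ` Pow {1..N}"
    using fin by (intro Max_in) auto
  then obtain X where "Max (mem ` Pow {1..N}) = mem X" by blast
  then show ?thesis
    using le unfolding mem_def ab by auto
qed

theorem theorem19:
  shows "\<exists>c\<^sub>0 > (0::real). \<exists>n\<^sub>0 :: nat.
    \<forall>(\<nu> :: sal_vertex \<Rightarrow> 'v) (F :: 'v pair_pre_digraph set) (A :: 'v stream_alg) (p :: nat \<Rightarrow> nat).
      inj \<nu> \<and>
      (\<forall>G\<in>F. pair_graph G \<and> pverts G \<noteq> {}) \<and>
      (\<forall>N\<ge>1. \<forall>x y. simple_AL \<nu> N x y \<in> F) \<and>
      (\<forall>n. p n \<ge> 1) \<and>
      solves_diameter A p F \<longrightarrow>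
      (\<forall>n\<ge>n\<^sub>0. \<forall>N\<ge>1. n = 2 * N + 3 \<longrightarrow>
        (\<exists>G\<in>F. \<exists>S. card (pverts G) = n \<and> al_stream G S \<and>
          real (alg_memory A (p n) S) \<ge> c\<^sub>0 * (real n / real (p n))))"
proof (intro exI[of _ "1 / 20"] exI[of _ 0] conjI allI impI; (elim conjE)?)
  fix \<nu> :: "sal_vertex \<Rightarrow> 'v" and F A and p :: "nat \<Rightarrow> nat" and n N :: nat
  assume inj: "inj \<nu>" and F: "\<forall>N\<ge>1. \<forall>x y. simple_AL \<nu> N x y \<in> F"
    and p: "\<forall>n. p n \<ge> 1" and A: "solves_diameter A p F" and N: "N \<ge> 1" "n = 2 * N + 3"
  have "alg_output A (p n) (sal_stream \<nu> N x y) = diameter (simple_AL \<nu> N x y)" for x y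
    using A F N al_stream_sal_stream[OF inj, of N x y] card_simple_AL[OF inj, of N x y]
    unfolding solves_diameter_def by metis
  then obtain x y where xy: "N \<le> 4 * p n * alg_memory A (p n) (sal_stream \<nu> N x y)"
    using alg_memory_simple_AL_ge[OF inj] by blast
  define M where "M = alg_memory A (p n) (sal_stream \<nu> N x y)"
  \<comment> \<open>From \<open>N \<ge> 1\<close> follows \<open>n = 2 * N + 3 \<le> 5 * N\<close>;
    with the factor 4 of the transcript bound this gives 20.\<close>
  have "n \<le> 20 * (M * p n)"
    using xy N unfolding M_def[symmetric] by (simp add: algebra_simps)
  then have "real n \<le> 20 * (real M * real (p n))"
    by (metis of_nat_le_iff of_nat_mult of_nat_numeral)
  moreover have "real (p n) > 0"
    using p[rule_format, of n] by simp
  ultimately have "1 / 20 * (real n / real (p n)) \<le> real M"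
    by (simp add: field_simps)
  then show "\<exists>G\<in>F. \<exists>S. card (pverts G) = n \<and> al_stream G S \<and>
      real (alg_memory A (p n) S) \<ge> 1 / 20 * (real n / real (p n))"
    using F N al_stream_sal_stream[OF inj, of N x y] card_simple_AL[OF inj, of N x y]
    unfolding M_def by (intro bexI[of _ "simple_AL \<nu> N x y"] exI[of _ "sal_stream \<nu> N x y"]) auto
qed simp

end
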